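(* Let $n\ge d\ge 1$ and let $\mu\in\mathcal{P}_2(\mathbb{R}^n)$, $\nu\in\mathcal{P}_2(\mathbb{R}^d)$ satisfy $$\int x\,d\mu(x)=0_n,\quad\int xx^\top d\mu(x)=I_n,\quad\int z\,d\nu(z)=0_d,\quad\int zz^\top d\nu(z)=I_d.$$ Let $c_{\mathcal{X}}(w,x)=\|w-x\|^2$ on $\mathbb{R}^n$ and $c_{\mathcal{Z}}(y,z)=\|y-z\|^2$ on $\mathbb{R}^d$. Then for any $A\in\mathcal{H}$ and $\gamma\in\Pi(\mu,\nu)$, $$\int c_{\mathcal{X}}(x,Az)\,d\gamma(x,z)=\int c_{\mathcal{Z}}(A^\top x,z)\,d\gamma(x,z)+(n-d).$$ In particular, $$\left(\mathbb{W}_2^{\uparrow}(\mu,\nu)\right)^2=\left(\mathbb{W}_2^{\downarrow}(\mu,\nu)\right)^2+(n-d),$$ and $A\in\mathcal{H}$ is optimal for $\mathbb{W}_2^{\uparrow}(\mu,\nu)$ if and only if it is optimal for $\mathbb{W}_2^{\downarrow}(\mu,\nu)$.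
   Context: $\mathcal{P}_2(\mathbb{R}^k)$ is the set of Borel probability measures on $\mathbb{R}^k$ with finite second moment; $\Pi(\mu,\nu)$ is the set of couplings of $\mu$ and $\nu$ (probability measures on $\mathbb{R}^n\times\mathbb{R}^d$ with marginals $\mu,\nu$); $\mathbb{W}_2$ is the $2$-Wasserstein distance for the Euclidean norm (on $\mathbb{R}^n$ or $\mathbb{R}^d$). $0_k$ and $I_k$ denote the zero vector and identity matrix. $\mathcal{H}:=\{A\in\mathbb{R}^{n\times d}:A^\top A=I_d\}$. $A^\top_\#\mu$ is the pushforward of $\mu$ under $x\mapsto A^\top x$ and $A_\#\nu$ is the pushforward of $\nu$ under $z\mapsto Az$. The downward and upward losses are $$\mathbb{W}_2^{\downarrow}(\mu,\nu):=\inf_{A\in\mathcal{H}}\mathbb{W}_2(A^\top_\#\mu,\nu),\qquad\mathbb{W}_2^{\uparrow}(\mu,\nu):=\inf_{A\in\mathcal{H}}\mathbb{W}_2(\mu,A_\#\nu).$$ $A\in\mathcal{H}$ is optimal for $\mathbb{W}_2^{\downarrow}(\mu,\nu)$ (resp. $\mathbb{W}_2^{\uparrow}(\mu,\nu)$) if it attains the corresponding infimum. *)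

theory Defs
  imports "HOL-Probability.Probability"
begin

definition P2 :: "('a::euclidean_space) measure set" where
  "P2 = {\<mu>. prob_space \<mu> \<and> sets \<mu> = sets borel \<and> integrable \<mu> (\<lambda>x. (norm x)\<^sup>2)}"

definition couplings ::
  "('a::euclidean_space) measure \<Rightarrow> ('b::euclidean_space) measure \<Rightarrow> ('a \<times> 'b) measure set" where
  "couplings \<mu> \<nu> = {\<gamma>. prob_space \<gamma> \<and> sets \<gamma> = sets borel
      \<and> distr \<gamma> borel fst = \<mu> \<and> distr \<gamma> borel snd = \<nu>}"

text \<open>
  The infimum of the transport costs is taken in the extended nonnegative reals, so that couplings of
  infinite cost count as such. On \<^const>\<open>P2\<close> the infimum is finite and the conversion to a
  real number loses nothing; the value is meaningless if the infimum is infinite.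
\<close>

definition W2 :: "('a::euclidean_space) measure \<Rightarrow> 'a measure \<Rightarrow> real" where
  "W2 \<mu> \<nu> = sqrt (enn2real
     (INF \<gamma>\<in>couplings \<mu> \<nu>. \<integral>\<^sup>+ p. ennreal ((norm (fst p - snd p))\<^sup>2) \<partial>\<gamma>))"

text \<open>A matrix with \<open>n\<close> rows and \<open>d\<close> columns has type \<^typ>\<open>real^'d^'n\<close>.\<close>

definition outer :: "real^'k \<Rightarrow> real^'k \<Rightarrow> real^'k^'k" where
  "outer x y = (\<chi> i j. x $ i * y $ j)"

definition ortho_mats :: "(real^'d^'n) set" where
  "ortho_mats = {A. transpose A ** A = mat 1}"

definition push_down :: "real^'d^'n \<Rightarrow> (real^'n) measure \<Rightarrow> (real^'d) measure" where
  "push_down A \<mu> = distr \<mu> borel (\<lambda>x. transpose A *v x)"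

definition push_up :: "real^'d^'n \<Rightarrow> (real^'d) measure \<Rightarrow> (real^'n) measure" where
  "push_up A \<nu> = distr \<nu> borel (\<lambda>z. A *v z)"

text \<open>
  The two infima below are infima of reals over \<^const>\<open>ortho_mats\<close>, which is nonempty exactly
  when \<open>d \<le> n\<close>; the values are meaningless otherwise.
\<close>

definition W2_down :: "(real^'n) measure \<Rightarrow> (real^'d) measure \<Rightarrow> real" where
  "W2_down \<mu> \<nu> = (INF A\<in>(ortho_mats :: (real^'d^'n) set). W2 (push_down A \<mu>) \<nu>)"

definition W2_up :: "(real^'n) measure \<Rightarrow> (real^'d) measure \<Rightarrow> real" where
  "W2_up \<mu> \<nu> = (INF A\<in>(ortho_mats :: (real^'d^'n) set). W2 \<mu> (push_up A \<nu>))"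

definition optimal_down :: "real^'d^'n \<Rightarrow> (real^'n) measure \<Rightarrow> (real^'d) measure \<Rightarrow> bool" where
  "optimal_down A \<mu> \<nu> \<longleftrightarrow> A \<in> ortho_mats \<and> W2 (push_down A \<mu>) \<nu> = W2_down \<mu> \<nu>"

definition optimal_up :: "real^'d^'n \<Rightarrow> (real^'n) measure \<Rightarrow> (real^'d) measure \<Rightarrow> bool" where
  "optimal_up A \<mu> \<nu> \<longleftrightarrow> A \<in> ortho_mats \<and> W2 \<mu> (push_up A \<nu>) = W2_up \<mu> \<nu>"

end

theory Submission
  imports Defs
begin

text \<open>
  For \<open>A\<close> with orthonormal columns, \<open>\<parallel>A z\<parallel> = \<parallel>z\<parallel>\<close> and \<open>x \<bullet> A z = A\<^sup>T x \<bullet> z\<close>, so expanding the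
  squares gives \<open>\<parallel>x - A z\<parallel>\<^sup>2 - \<parallel>A\<^sup>T x - z\<parallel>\<^sup>2 = \<parallel>x\<parallel>\<^sup>2 - \<parallel>A\<^sup>T x\<parallel>\<^sup>2\<close>. The right-hand side depends
  on \<open>x\<close> only, and because \<open>\<mu>\<close> has second-moment matrix \<open>I\<close> its integral is \<open>n - d\<close>, whatever
  the coupling (\<open>coupling_cost_identity\<close>).

  To pass to the Wasserstein distances, both \<open>W2 \<mu> (push_up A \<nu>)\<close> and \<open>W2 (push_down A \<mu>) \<nu>\<close> have
  to be written as infima over one and the same set, the couplings of \<open>\<mu>\<close> and \<open>\<nu>\<close>. Pushing a coupling
  of \<open>\<mu>\<close> and \<open>\<nu>\<close> forward is immediate; conversely a coupling of \<open>T\<^sub>#\<mu>\<close> and \<open>\<nu>\<close> has to be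
  lifted along \<open>T\<close>, which is classically done by disintegration. Since only infima matter, an
  approximate lift is enough, and it is elementary: cut the target space into countably many cells
  of diameter at most \<open>\<delta>\<close> and glue \<open>\<mu>\<close> to the given coupling, conditionally independently, along
  the cell index (\<open>discrete_gluing\<close>). The lift has the right marginals, and moves the first coordinate
  by less than \<open>\<delta>\<close>, so its cost is arbitrarily close to the original one
  (\<open>approximate_lift_coupling\<close>, \<open>INF_couplings_distr\<close>).

  Hence the squared distances for a fixed \<open>A\<close> differ by the constant \<open>n - d\<close> (\<open>W2_push_up_sq\<close>).
  The map \<open>w \<mapsto> sqrt (w\<^sup>2 + (n - d))\<close> is increasing and continuous on \<open>w \<ge> 0\<close>, so it commutes with the
  infimum over \<open>A\<close> (\<open>INF_sqrt_add_const\<close>), and it is injective, so both infima are attained at the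
  same matrices.
\<close>

section \<open>Gluing along a discrete variable\<close>

lemma AE_fibre_not_null:
  fixes f :: "'a \<Rightarrow> 'c::countable"
  assumes [measurable]: "f \<in> measurable M (count_space UNIV)"
  shows "AE x in M. emeasure M (f -` {f x} \<inter> space M) \<noteq> 0"
proof -
  have "AE x in M. emeasure M (f -` {k} \<inter> space M) = 0 \<longrightarrow> f x \<noteq> k" for k
  proof (cases "emeasure M (f -` {k} \<inter> space M) = 0")
    case True
    then show ?thesis
      by (intro AE_I[where N = "f -` {k} \<inter> space M"]) auto
  qed simp
  then have "AE x in M. \<forall>k. emeasure M (f -` {k} \<inter> space M) = 0 \<longrightarrow> f x \<noteq> k"
    by (simp add: AE_all_countable)
  then show ?thesis by (rule AE_mp) auto
qed

text \<open>
  Two variables with the same law on a countable set can be made equal by drawing the common value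
  first and then the two points independently from the two fibres. That measure has the explicit
  density \<open>1 / m k\<close> with respect to \<open>M \<Otimes>\<^sub>M N\<close> on each product of fibres over \<open>k\<close>, where
  \<open>m k\<close> is the mass of the fibre, the same in \<open>M\<close> and in \<open>N\<close>. So the marginals come out of
  Tonelli's theorem.
\<close>

lemma discrete_gluing:
  fixes f :: "'a \<Rightarrow> 'c::countable" and g :: "'b \<Rightarrow> 'c"
  assumes "prob_space M" and "prob_space N"
    and f [measurable]: "f \<in> measurable M (count_space UNIV)"
    and g [measurable]: "g \<in> measurable N (count_space UNIV)"
    and law: "distr M (count_space UNIV) f = distr N (count_space UNIV) g"
  obtains G where "sets G = sets (M \<Otimes>\<^sub>M N)" and "distr G M fst = M" and "distr G N snd = N"
    and "AE p in G. f (fst p) = g (snd p)"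
proof -
  interpret M: prob_space M by fact
  interpret N: prob_space N by fact
  interpret MN: pair_prob_space M N ..
  define m where "m k = emeasure M (f -` {k} \<inter> space M)" for k
  have m_N: "m k = emeasure N (g -` {k} \<inter> space N)" for k
  proof -
    have "emeasure (distr M (count_space UNIV) f) {k} = emeasure (distr N (count_space UNIV) g) {k}"
      by (simp add: law)
    then show ?thesis by (simp add: emeasure_distr m_def)
  qed
  have m_fin: "m k \<noteq> \<infinity>" for k
    by (simp add: m_def)
  \<comment> \<open>On fibres of mass zero the density is infinite; almost no point lies in such a fibre.\<close>
  define D where "D = (\<lambda>(x, y). inverse (m (f x)) * indicator {y. g y = f x} y)"
  have [measurable]: "D \<in> borel_measurable (M \<Otimes>\<^sub>M N)"
    unfolding D_def indicator_def by measurable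
  have AE_M: "AE x in M. m (f x) \<noteq> 0"
    unfolding m_def by (rule AE_fibre_not_null) measurable
  have AE_N: "AE y in N. m (g y) \<noteq> 0"
    unfolding m_N by (rule AE_fibre_not_null) measurable
  have slice_M: "(\<integral>\<^sup>+ y. D (x, y) \<partial>N) = 1" if "m (f x) \<noteq> 0" for x
  proof -
    have "(\<integral>\<^sup>+ y. D (x, y) \<partial>N) = (\<integral>\<^sup>+ y. inverse (m (f x)) * indicator (g -` {f x} \<inter> space N) y \<partial>N)"
      by (rule nn_integral_cong) (auto simp: D_def indicator_def)
    also have "\<dots> = inverse (m (f x)) * m (f x)"
      by (subst nn_integral_cmult_indicator) (auto simp: m_N)
    also have "\<dots> = 1" using that m_fin
      by (simp add: ennreal_inverse_mult less_top mult.commute ennreal_mult_divide_eq flip: divide_ennreal_def)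
    finally show ?thesis .
  qed
  have slice_N: "(\<integral>\<^sup>+ x. D (x, y) \<partial>M) = 1" if "m (g y) \<noteq> 0" for y
  proof -
    have "(\<integral>\<^sup>+ x. D (x, y) \<partial>M) = (\<integral>\<^sup>+ x. inverse (m (g y)) * indicator (f -` {g y} \<inter> space M) x \<partial>M)"
      by (rule nn_integral_cong) (auto simp: D_def indicator_def)
    also have "\<dots> = inverse (m (g y)) * m (g y)"
      by (subst nn_integral_cmult_indicator) (auto simp: m_def)
    also have "\<dots> = 1" using that m_fin
      by (simp add: ennreal_inverse_mult less_top mult.commute ennreal_mult_divide_eq flip: divide_ennreal_def)
    finally show ?thesis .
  qed
  define G where "G = density (M \<Otimes>\<^sub>M N) D"
  have sets_G: "sets G = sets (M \<Otimes>\<^sub>M N)" by (simp add: G_def)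
  have "distr G M fst = M"
  proof (rule measure_eqI)
    fix A assume "A \<in> sets (distr G M fst)"
    then have A [measurable]: "A \<in> sets M" by simp
    have "emeasure (distr G M fst) A = emeasure G (fst -` A \<inter> space (M \<Otimes>\<^sub>M N))"
      by (subst emeasure_distr) (auto simp: measurable_cong_sets[OF sets_G refl] G_def)
    also have "\<dots> = (\<integral>\<^sup>+ p. D p * indicator (fst -` A \<inter> space (M \<Otimes>\<^sub>M N)) p \<partial>(M \<Otimes>\<^sub>M N))"
      unfolding G_def by (rule emeasure_density) measurable
    also have "\<dots> = (\<integral>\<^sup>+ p. D p * indicator A (fst p) \<partial>(M \<Otimes>\<^sub>M N))"
      by (rule nn_integral_cong) (auto simp: indicator_def)
    also have "\<dots> = (\<integral>\<^sup>+ x. \<integral>\<^sup>+ y. D (x, y) * indicator A x \<partial>N \<partial>M)"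
      by (subst N.nn_integral_fst[symmetric]) auto
    also have "\<dots> = (\<integral>\<^sup>+ x. (\<integral>\<^sup>+ y. D (x, y) \<partial>N) * indicator A x \<partial>M)"
      by (intro nn_integral_cong nn_integral_multc) measurable
    also have "\<dots> = (\<integral>\<^sup>+ x. indicator A x \<partial>M)"
      using AE_M by (intro nn_integral_cong_AE) (auto simp: slice_M)
    finally show "emeasure (distr G M fst) A = emeasure M A" by simp
  qed simp
  moreover have "distr G N snd = N"
  proof (rule measure_eqI)
    fix A assume "A \<in> sets (distr G N snd)"
    then have A [measurable]: "A \<in> sets N" by simp
    have "emeasure (distr G N snd) A = emeasure G (snd -` A \<inter> space (M \<Otimes>\<^sub>M N))"
      by (subst emeasure_distr) (auto simp: measurable_cong_sets[OF sets_G refl] G_def)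
    also have "\<dots> = (\<integral>\<^sup>+ p. D p * indicator (snd -` A \<inter> space (M \<Otimes>\<^sub>M N)) p \<partial>(M \<Otimes>\<^sub>M N))"
      unfolding G_def by (rule emeasure_density) measurable
    also have "\<dots> = (\<integral>\<^sup>+ p. D p * indicator A (snd p) \<partial>(M \<Otimes>\<^sub>M N))"
      by (rule nn_integral_cong) (auto simp: indicator_def)
    also have "\<dots> = (\<integral>\<^sup>+ y. \<integral>\<^sup>+ x. D (x, y) * indicator A y \<partial>M \<partial>N)"
      by (subst MN.nn_integral_snd[symmetric]) auto
    also have "\<dots> = (\<integral>\<^sup>+ y. (\<integral>\<^sup>+ x. D (x, y) \<partial>M) * indicator A y \<partial>N)"
      by (intro nn_integral_cong nn_integral_multc) measurable
    also have "\<dots> = (\<integral>\<^sup>+ y. indicator A y \<partial>N)"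
      using AE_N by (intro nn_integral_cong_AE) (auto simp: slice_N)
    finally show "emeasure (distr G N snd) A = emeasure N A" by simp
  qed simp
  moreover have "AE p in G. f (fst p) = g (snd p)"
    unfolding G_def by (subst AE_density) (auto simp: D_def zero_less_iff_neq_zero indicator_eq_0_iff intro!: AE_I2)
  ultimately show ?thesis using that sets_G by blast
qed

text \<open>
  Mapping a point to the first member of a dense sequence that is closer than \<open>\<delta> / 2\<close> cuts the space
  into countably many Borel cells of diameter at most \<open>\<delta>\<close>.
\<close>

lemma countable_quantizer:
  fixes \<delta> :: real
  assumes "\<delta> > 0"
  obtains q :: "'a::{metric_space, second_countable_topology} \<Rightarrow> nat"
    where "q \<in> measurable borel (count_space UNIV)" and "\<And>x y. q x = q y \<Longrightarrow> dist x y < \<delta>"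
proof -
  obtain S :: "'a set" where S: "countable S" "\<And>U. open U \<Longrightarrow> U \<noteq> {} \<Longrightarrow> \<exists>s\<in>S. s \<in> U"
    by (rule countable_dense_setE) blast
  define c where "c = from_nat_into S"
  have S_ne: "S \<noteq> {}" using S(2)[of UNIV] by auto
  have near: "\<exists>k. dist x (c k) < \<delta> / 2" for x
  proof -
    obtain s where "s \<in> S" "s \<in> ball x (\<delta> / 2)"
      using S(2)[of "ball x (\<delta> / 2)"] assms by auto
    then show ?thesis
      using from_nat_into_surj[OF S(1)] by (force simp: c_def)
  qed
  define q where "q x = (LEAST k. dist x (c k) < \<delta> / 2)" for x
  have "q \<in> measurable borel (count_space UNIV)"
    unfolding q_def by measurable
  moreover have "dist x y < \<delta>" if "q x = q y" for x y
    using LeastI_ex[OF near[of x]] LeastI_ex[OF near[of y]] that dist_triangle_half_l[of x "c (q x)" \<delta> y]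
    by (simp add: q_def)
  ultimately show ?thesis using that by blast
qed

section \<open>Transport costs between image measures\<close>

lemma
  assumes "\<gamma> \<in> couplings \<mu> \<nu>"
  shows prob_space_coupling: "prob_space \<gamma>" and sets_coupling: "sets \<gamma> = sets (borel \<Otimes>\<^sub>M borel)"
    and coupling_fst: "distr \<gamma> borel fst = \<mu>" and coupling_snd: "distr \<gamma> borel snd = \<nu>"
  using assms unfolding couplings_def borel_prod by auto

lemma distr_map_prod_coupling:
  assumes \<gamma>: "\<gamma> \<in> couplings \<mu> \<nu>"
    and T [measurable]: "T \<in> borel_measurable borel" and S [measurable]: "S \<in> borel_measurable borel"
  shows "distr \<gamma> borel (\<lambda>p. (T (fst p), S (snd p))) \<in> couplings (distr \<mu> borel T) (distr \<nu> borel S)"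
proof -
  interpret prob_space \<gamma> by (rule prob_space_coupling[OF \<gamma>])
  note [measurable_cong] = sets_coupling[OF \<gamma>]
  have "prob_space (distr \<gamma> borel (\<lambda>p. (T (fst p), S (snd p))))"
    by (rule prob_space_distr) measurable
  then show ?thesis
    unfolding couplings_def coupling_fst[OF \<gamma>, symmetric] coupling_snd[OF \<gamma>, symmetric]
      borel_prod[symmetric]
    by (auto simp: distr_distr comp_def)
qed

lemma distr_swap_coupling:
  assumes \<gamma>: "\<gamma> \<in> couplings \<mu> \<nu>"
  shows "distr \<gamma> borel prod.swap \<in> couplings \<nu> \<mu>"
proof -
  interpret prob_space \<gamma> by (rule prob_space_coupling[OF \<gamma>])
  note [measurable_cong] = sets_coupling[OF \<gamma>]
  have [measurable]: "prod.swap \<in> measurable \<gamma> (borel \<Otimes>\<^sub>M borel)"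
    unfolding prod.swap_def by measurable
  have "prob_space (distr \<gamma> (borel \<Otimes>\<^sub>M borel) prod.swap)"
    by (rule prob_space_distr) measurable
  then show ?thesis
    unfolding couplings_def coupling_fst[OF \<gamma>, symmetric] coupling_snd[OF \<gamma>, symmetric]
      borel_prod[symmetric]
    by (auto simp: distr_distr comp_def)
qed

text \<open>
  With this symmetry a single lifting result, for image measures in the first marginal, serves both
  the downward and the upward distance.
\<close>

lemma INF_couplings_swap:
  assumes [measurable]: "h \<in> borel_measurable borel"
  shows "(INF \<gamma>\<in>couplings \<mu> \<nu>. \<integral>\<^sup>+ p. h p \<partial>\<gamma>) = (INF \<gamma>\<in>couplings \<nu> \<mu>. \<integral>\<^sup>+ p. h (prod.swap p) \<partial>\<gamma>)"
proof -
  have swap [measurable]: "prod.swap \<in> borel_measurable (borel :: ('x::euclidean_space \<times> 'y::euclidean_space) measure)"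
    unfolding prod.swap_def borel_prod[symmetric] by measurable
  have cost: "(\<integral>\<^sup>+ p. k p \<partial>distr \<gamma> borel prod.swap) = (\<integral>\<^sup>+ p. k (prod.swap p) \<partial>\<gamma>)"
    if "\<gamma> \<in> couplings \<mu>' \<nu>'" "k \<in> borel_measurable borel"
    for \<gamma> and \<mu>' :: "'x::euclidean_space measure" and \<nu>' :: "'y::euclidean_space measure" and k
  proof -
    have sets: "sets \<gamma> = sets borel"
      using sets_coupling[OF that(1)] unfolding borel_prod .
    have "prod.swap \<in> borel_measurable \<gamma>"
      unfolding measurable_cong_sets[OF sets refl] by (rule swap)
    then show ?thesis using that(2) by (simp add: nn_integral_distr)
  qed
  show ?thesis
  proof (rule antisym; rule INF_greatest)
    fix \<gamma> assume "\<gamma> \<in> couplings \<nu> \<mu>"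
    then show "(INF \<gamma>\<in>couplings \<mu> \<nu>. \<integral>\<^sup>+ p. h p \<partial>\<gamma>) \<le> (\<integral>\<^sup>+ p. h (prod.swap p) \<partial>\<gamma>)"
      by (subst cost[symmetric]) (auto intro!: INF_lower distr_swap_coupling)
  next
    fix \<gamma> assume \<gamma>: "\<gamma> \<in> couplings \<mu> \<nu>"
    have "(INF \<gamma>\<in>couplings \<nu> \<mu>. \<integral>\<^sup>+ p. h (prod.swap p) \<partial>\<gamma>)
        \<le> (\<integral>\<^sup>+ p. h (prod.swap p) \<partial>distr \<gamma> borel prod.swap)"
      by (intro INF_lower distr_swap_coupling \<gamma>)
    also have "\<dots> = (\<integral>\<^sup>+ p. h p \<partial>\<gamma>)"
      by (subst cost[OF \<gamma>]) auto
    finally show "(INF \<gamma>\<in>couplings \<nu> \<mu>. \<integral>\<^sup>+ p. h (prod.swap p) \<partial>\<gamma>) \<le> (\<integral>\<^sup>+ p. h p \<partial>\<gamma>)" .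
  qed
qed

text \<open>
  Glue \<open>\<mu>\<close> to \<open>\<gamma>\<close> so that \<open>T x\<close> and \<open>w\<close> lie in the same cell for almost every triple \<open>(x, (w, z))\<close>,
  and forget \<open>w\<close>. As the pair \<open>(w, z)\<close> keeps its law \<open>\<gamma>\<close>, replacing \<open>w\<close> by the nearby point \<open>T x\<close>
  is the only source of extra cost.
\<close>

lemma approximate_lift_coupling:
  fixes T :: "'a::euclidean_space \<Rightarrow> 'b::euclidean_space" and \<nu> :: "'b measure"
  assumes \<mu>: "prob_space \<mu>" "sets \<mu> = sets borel"
    and T [measurable]: "T \<in> borel_measurable borel"
    and \<gamma>: "\<gamma> \<in> couplings (distr \<mu> borel T) \<nu>"
    and "\<delta> > 0"
  obtains \<gamma>' where "\<gamma>' \<in> couplings \<mu> \<nu>"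
    and "(\<integral>\<^sup>+ p. ennreal ((norm (T (fst p) - snd p))\<^sup>2) \<partial>\<gamma>')
      \<le> ennreal (1 + \<delta>) * (\<integral>\<^sup>+ p. ennreal ((norm (fst p - snd p))\<^sup>2) \<partial>\<gamma>) + ennreal (\<delta> + \<delta>\<^sup>2)"
proof -
  interpret \<gamma>: prob_space \<gamma> by (rule prob_space_coupling[OF \<gamma>])
  note [measurable_cong] = sets_coupling[OF \<gamma>] \<mu>(2)
  obtain q :: "'b \<Rightarrow> nat" where q [measurable]: "q \<in> measurable borel (count_space UNIV)"
    and q_near: "\<And>x y. q x = q y \<Longrightarrow> dist x y < \<delta>"
    using countable_quantizer[OF \<open>\<delta> > 0\<close>] by metis
  have "distr \<mu> (count_space UNIV) (\<lambda>x. q (T x)) = distr (distr \<mu> borel T) (count_space UNIV) q"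
    by (simp add: distr_distr comp_def)
  also have "\<dots> = distr \<gamma> (count_space UNIV) (\<lambda>p. q (fst p))"
    by (simp add: distr_distr comp_def flip: coupling_fst[OF \<gamma>])
  finally have law: "distr \<mu> (count_space UNIV) (\<lambda>x. q (T x)) = distr \<gamma> (count_space UNIV) (\<lambda>p. q (fst p))" .
  obtain G where sets_G: "sets G = sets (\<mu> \<Otimes>\<^sub>M \<gamma>)" and G1: "distr G \<mu> fst = \<mu>"
    and G2: "distr G \<gamma> snd = \<gamma>" and G_eq: "AE p in G. q (T (fst p)) = q (fst (snd p))"
    using discrete_gluing[OF \<mu>(1) \<gamma>.prob_space_axioms _ _ law] by auto measurable
  note [measurable_cong] = sets_G
  have "prob_space G"
    using prob_space_distrD[of fst G \<mu>] \<mu>(1) G1 by auto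
  then interpret G: prob_space G .
  define \<gamma>' where "\<gamma>' = distr G (borel \<Otimes>\<^sub>M borel) (\<lambda>p. (fst p, snd (snd p)))"
  have "\<gamma>' \<in> couplings \<mu> \<nu>"
  proof -
    have "distr \<gamma>' borel fst = distr G borel fst"
      by (simp add: \<gamma>'_def distr_distr comp_def)
    also have "\<dots> = distr G \<mu> fst" by (rule distr_cong) (simp_all add: \<mu>(2))
    finally have 1: "distr \<gamma>' borel fst = \<mu>" by (simp add: G1)
    have "distr \<gamma>' borel snd = distr (distr G \<gamma> snd) borel snd"
      by (simp add: \<gamma>'_def distr_distr comp_def)
    then have 2: "distr \<gamma>' borel snd = \<nu>" by (simp add: G2 coupling_snd[OF \<gamma>])
    have "prob_space \<gamma>'" unfolding \<gamma>'_def by (rule G.prob_space_distr) measurable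
    moreover have "sets \<gamma>' = sets borel" unfolding \<gamma>'_def borel_prod by simp
    ultimately show ?thesis using 1 2 by (simp add: couplings_def)
  qed
  moreover have "(\<integral>\<^sup>+ p. ennreal ((norm (T (fst p) - snd p))\<^sup>2) \<partial>\<gamma>')
      \<le> ennreal (1 + \<delta>) * (\<integral>\<^sup>+ p. ennreal ((norm (fst p - snd p))\<^sup>2) \<partial>\<gamma>) + ennreal (\<delta> + \<delta>\<^sup>2)"
  proof -
    have bound: "(norm (t - z))\<^sup>2 \<le> (1 + \<delta>) * (norm (w - z))\<^sup>2 + (\<delta> + \<delta>\<^sup>2)" if "q t = q w" for t w z :: 'b
    proof -
      let ?a = "norm (w - z)"
      have "norm (t - z) \<le> ?a + \<delta>"
        using q_near[OF that] norm_triangle_ineq[of "t - w" "w - z"] by (simp add: dist_norm)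
      then have "(norm (t - z))\<^sup>2 \<le> (?a + \<delta>)\<^sup>2" by (rule power_mono) simp
      \<comment> \<open>The mixed term: \<open>2 a \<delta> \<le> \<delta> a\<^sup>2 + \<delta>\<close>.\<close>
      moreover have "0 \<le> \<delta> * (?a - 1)\<^sup>2" using \<open>\<delta> > 0\<close> by simp
      ultimately show ?thesis by (simp add: power2_eq_square algebra_simps)
    qed
    have "(\<integral>\<^sup>+ p. ennreal ((norm (T (fst p) - snd p))\<^sup>2) \<partial>\<gamma>')
        = (\<integral>\<^sup>+ p. ennreal ((norm (T (fst p) - snd (snd p)))\<^sup>2) \<partial>G)"
      unfolding \<gamma>'_def by (subst nn_integral_distr) auto
    also have "\<dots> \<le> (\<integral>\<^sup>+ p. ennreal (1 + \<delta>) * ennreal ((norm (fst (snd p) - snd (snd p)))\<^sup>2) + ennreal (\<delta> + \<delta>\<^sup>2) \<partial>G)"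
    proof (rule nn_integral_mono_AE, use G_eq in eventually_elim)
      fix p :: "'a \<times> 'b \<times> 'b" assume "q (T (fst p)) = q (fst (snd p))"
      from bound[OF this, of "snd (snd p)"]
      show "ennreal ((norm (T (fst p) - snd (snd p)))\<^sup>2)
          \<le> ennreal (1 + \<delta>) * ennreal ((norm (fst (snd p) - snd (snd p)))\<^sup>2) + ennreal (\<delta> + \<delta>\<^sup>2)"
        using \<open>\<delta> > 0\<close> by (simp add: ennreal_leI flip: ennreal_mult ennreal_plus)
    qed
    also have "\<dots> = ennreal (1 + \<delta>) * (\<integral>\<^sup>+ p. ennreal ((norm (fst (snd p) - snd (snd p)))\<^sup>2) \<partial>G) + ennreal (\<delta> + \<delta>\<^sup>2)"
      by (subst nn_integral_add) (auto simp: nn_integral_cmult G.emeasure_space_1)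
    also have "(\<integral>\<^sup>+ p. ennreal ((norm (fst (snd p) - snd (snd p)))\<^sup>2) \<partial>G)
        = (\<integral>\<^sup>+ p. ennreal ((norm (fst p - snd p))\<^sup>2) \<partial>distr G \<gamma> snd)"
      by (subst nn_integral_distr) auto
    finally show ?thesis by (simp only: G2)
  qed
  ultimately show ?thesis using that by blast
qed

text \<open>
  Exact for every Borel map \<open>T\<close>, although the lifts are only approximate: the error disappears in
  the infimum as \<open>\<delta>\<close> tends to \<open>0\<close>.
\<close>

lemma INF_couplings_distr:
  fixes T :: "'a::euclidean_space \<Rightarrow> 'b::euclidean_space" and \<nu> :: "'b measure"
  assumes \<mu>: "prob_space \<mu>" "sets \<mu> = sets borel" and \<nu>: "sets \<nu> = sets borel"
    and T [measurable]: "T \<in> borel_measurable borel"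
  shows "(INF \<gamma>\<in>couplings (distr \<mu> borel T) \<nu>. \<integral>\<^sup>+ p. ennreal ((norm (fst p - snd p))\<^sup>2) \<partial>\<gamma>)
    = (INF \<gamma>\<in>couplings \<mu> \<nu>. \<integral>\<^sup>+ p. ennreal ((norm (T (fst p) - snd p))\<^sup>2) \<partial>\<gamma>)" (is "?L = ?R")
proof (rule antisym)
  show "?L \<le> ?R"
  proof (rule INF_greatest)
    fix \<gamma> assume \<gamma>: "\<gamma> \<in> couplings \<mu> \<nu>"
    note [measurable_cong] = sets_coupling[OF \<gamma>]
    have "distr \<nu> borel (\<lambda>z. z) = \<nu>"
      using distr_id2[of borel \<nu>] \<nu> by simp
    then have "distr \<gamma> borel (\<lambda>p. (T (fst p), snd p)) \<in> couplings (distr \<mu> borel T) \<nu>"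
      using distr_map_prod_coupling[OF \<gamma> T, of "\<lambda>z. z"] by simp
    then have "?L \<le> (\<integral>\<^sup>+ p. ennreal ((norm (fst p - snd p))\<^sup>2) \<partial>distr \<gamma> borel (\<lambda>p. (T (fst p), snd p)))"
      by (rule INF_lower)
    also have "\<dots> = (\<integral>\<^sup>+ p. ennreal ((norm (T (fst p) - snd p))\<^sup>2) \<partial>\<gamma>)"
      unfolding borel_prod[symmetric] by (subst nn_integral_distr) auto
    finally show "?L \<le> (\<integral>\<^sup>+ p. ennreal ((norm (T (fst p) - snd p))\<^sup>2) \<partial>\<gamma>)" .
  qed
  show "?R \<le> ?L"
  proof (rule INF_greatest)
    fix \<gamma> assume \<gamma>: "\<gamma> \<in> couplings (distr \<mu> borel T) \<nu>"
    let ?C = "\<integral>\<^sup>+ p. ennreal ((norm (fst p - snd p))\<^sup>2) \<partial>\<gamma>"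
    have le: "?R \<le> ennreal (1 + \<delta>) * ?C + ennreal (\<delta> + \<delta>\<^sup>2)" if "\<delta> > 0" for \<delta> :: real
      using approximate_lift_coupling[OF \<mu> T \<gamma> that] by (metis (no_types, lifting) INF_lower2)
    show "?R \<le> ?C"
    proof (cases ?C)
      case (real c)
      have "((\<lambda>\<delta>. ennreal ((1 + \<delta>) * c + (\<delta> + \<delta>\<^sup>2))) \<longlongrightarrow> ennreal ((1 + 0) * c + (0 + 0\<^sup>2))) (at_right (0::real))"
        by (intro tendsto_intros)
      then have "?R \<le> ennreal ((1 + 0) * c + (0 + 0\<^sup>2))"
      proof (rule tendsto_lowerbound)
        show "\<forall>\<^sub>F \<delta> in at_right 0. ?R \<le> ennreal ((1 + \<delta>) * c + (\<delta> + \<delta>\<^sup>2))"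
          unfolding eventually_at_right_field
        proof (intro exI[of _ 1] conjI allI impI)
          fix \<delta> :: real assume "0 < \<delta>"
          then show "?R \<le> ennreal ((1 + \<delta>) * c + (\<delta> + \<delta>\<^sup>2))"
            using le[of \<delta>] real by (simp add: ennreal_plus ennreal_mult)
        qed simp
      qed simp
      then show ?thesis using real by simp
    qed (simp add: top_unique)
  qed
qed

section \<open>Second moments\<close>

text \<open>
  The square \<open>(u \<bullet> x)\<^sup>2\<close> is the value at \<open>outer x x\<close> of the linear functional \<open>M \<mapsto> u \<bullet> M u\<close>,
  which commutes with the integral.
\<close>

lemma isotropic_quadratic:
  fixes \<mu> :: "(real^'k) measure"
  assumes iso: "(LINT x|\<mu>. outer x x) = mat 1"
  shows "integrable \<mu> (\<lambda>x. (u \<bullet> x)\<^sup>2)" and "(LINT x|\<mu>. (u \<bullet> x)\<^sup>2) = (norm u)\<^sup>2"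
proof -
  have int: "integrable \<mu> (\<lambda>x. outer x x)"
  proof (rule ccontr)
    \<comment> \<open>A Bochner integral is \<open>0\<close> by convention when it does not exist, and \<open>mat 1\<close> is not \<open>0\<close>.\<close>
    assume "\<not> ?thesis"
    then have "(mat 1 :: real^'k^'k) = 0" using iso not_integrable_integral_eq by metis
    then have "(mat 1 :: real^'k^'k) $ i $ i = 0" for i by simp
    then show False by (simp add: mat_def)
  qed
  let ?L = "\<lambda>M :: real^'k^'k. u \<bullet> (M *v u)"
  have "linear ?L"
    by (rule linearI)
      (simp_all add: matrix_vector_mult_add_rdistrib inner_add_right scaleR_matrix_vector_assoc[symmetric])
  then have L: "bounded_linear ?L" by (rule linear_conv_bounded_linear[THEN iffD1])
  have eq: "?L (outer x x) = (u \<bullet> x)\<^sup>2" for x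
  proof -
    have "outer x x *v u = (u \<bullet> x) *\<^sub>R x"
      by (simp add: vec_eq_iff outer_def matrix_vector_mult_def inner_vec_def sum_distrib_left mult_ac)
    then show ?thesis by (simp add: power2_eq_square)
  qed
  show "integrable \<mu> (\<lambda>x. (u \<bullet> x)\<^sup>2)"
    using integrable_bounded_linear[OF L int] by (simp only: eq)
  have "(LINT x|\<mu>. (u \<bullet> x)\<^sup>2) = ?L (mat 1)"
    using integral_bounded_linear[OF L int] by (simp only: eq iso)
  then show "(LINT x|\<mu>. (u \<bullet> x)\<^sup>2) = (norm u)\<^sup>2"
    by (simp add: dot_square_norm)
qed

lemma isotropic_norm_matrix_mult:
  fixes \<mu> :: "(real^'k) measure" and B :: "real^'k^'m"
  assumes "(LINT x|\<mu>. outer x x) = mat 1"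
  shows "integrable \<mu> (\<lambda>x. (norm (B *v x))\<^sup>2)"
    and "(LINT x|\<mu>. (norm (B *v x))\<^sup>2) = (\<Sum>i\<in>UNIV. (norm (B $ i))\<^sup>2)"
proof -
  have "(norm (B *v x))\<^sup>2 = (\<Sum>i\<in>UNIV. (B $ i \<bullet> x)\<^sup>2)" for x
  proof -
    have "(norm (B *v x))\<^sup>2 = (\<Sum>i\<in>UNIV. (B *v x) $ i \<bullet> (B *v x) $ i)"
      unfolding power2_norm_eq_inner by (rule inner_vec_def)
    then show ?thesis by (simp add: matrix_mult_dot power2_eq_square)
  qed
  then show "integrable \<mu> (\<lambda>x. (norm (B *v x))\<^sup>2)"
    and "(LINT x|\<mu>. (norm (B *v x))\<^sup>2) = (\<Sum>i\<in>UNIV. (norm (B $ i))\<^sup>2)"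
    by (simp_all add: isotropic_quadratic[OF assms])
qed

lemma ortho_mats_norm:
  assumes "A \<in> ortho_mats"
  shows "norm (A *v z) = norm z"
proof -
  have "(A *v z) \<bullet> (A *v z) = ((transpose A ** A) *v z) \<bullet> z"
    by (simp add: dot_lmul_matrix flip: matrix_vector_mul_assoc)
  then show ?thesis using assms by (simp add: ortho_mats_def norm_eq)
qed

lemma ortho_mats_norm_transpose_row:
  assumes "A \<in> ortho_mats"
  shows "norm (transpose A $ j) = 1"
proof -
  have "(transpose A ** A) $ j $ j = 1" using assms by (simp add: ortho_mats_def mat_def)
  then show ?thesis
    by (simp add: norm_eq_1 inner_vec_def matrix_matrix_mult_def transpose_def)
qed

lemma ortho_mats_cost_difference:
  assumes "A \<in> ortho_mats"
  shows "(norm (x - A *v z))\<^sup>2 + (norm (transpose A *v x))\<^sup>2 = (norm (transpose A *v x - z))\<^sup>2 + (norm x)\<^sup>2"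
proof -
  have "x \<bullet> (A *v z) = (transpose A *v x) \<bullet> z"
    by (simp add: dot_lmul_matrix)
  then show ?thesis
    using ortho_mats_norm[OF assms, of z]
    by (simp add: power2_norm_eq_inner inner_diff_left inner_diff_right inner_commute norm_eq)
qed

lemma ortho_mats_nonempty:
  assumes "CARD('d) \<le> CARD('n)"
  shows "(ortho_mats :: (real^'d^'n) set) \<noteq> {}"
proof -
  obtain f :: "'d \<Rightarrow> 'n" where f: "inj f"
    using card_le_inj[of "UNIV :: 'd set" "UNIV :: 'n set"] assms by auto
  \<comment> \<open>The columns are distinct standard basis vectors.\<close>
  define A :: "real^'d^'n" where "A = (\<chi> i j. axis (f j) 1 $ i)"
  have "(transpose A ** A) $ j $ k = axis (f j) 1 \<bullet> (axis (f k) 1 :: real^'n)" for j k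
    by (simp add: A_def matrix_matrix_mult_def transpose_def inner_vec_def)
  then have "(transpose A ** A) $ j $ k = (mat 1 :: real^'d^'d) $ j $ k" for j k
    by (simp add: inner_axis_axis inj_eq[OF f] mat_def)
  then have "A \<in> ortho_mats" by (simp add: ortho_mats_def vec_eq_iff)
  then show ?thesis by blast
qed

section \<open>Comparison of the two losses\<close>

lemma borel_measurable_matrix_vector_mult [measurable]:
  fixes B :: "real^'x^'y"
  shows "(\<lambda>v. B *v v) \<in> borel_measurable borel"
  by (intro borel_measurable_continuous_onI linear_continuous_on) simp

text \<open>
  The difference of the two integrands is \<open>\<parallel>x\<parallel>\<^sup>2 - \<parallel>A\<^sup>T x\<parallel>\<^sup>2\<close>, a function of
  \<open>x\<close> alone. Its integral therefore sees only the marginal \<open>\<mu>\<close>, and isotropy evaluates it as the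
  number of coordinates of \<open>x\<close> minus the number of columns of \<open>A\<close>, these being unit vectors.
\<close>

lemma coupling_cost_identity:
  fixes \<mu> :: "(real^'n) measure" and \<nu> :: "(real^'d) measure" and A :: "real^'d^'n"
  assumes \<mu>: "\<mu> \<in> P2" and \<nu>: "\<nu> \<in> P2" and iso: "(LINT x|\<mu>. outer x x) = mat 1"
    and A: "A \<in> ortho_mats" and \<gamma>: "\<gamma> \<in> couplings \<mu> \<nu>"
  shows "integrable \<gamma> (\<lambda>(x, z). (norm (x - A *v z))\<^sup>2)"
    and "integrable \<gamma> (\<lambda>(x, z). (norm (transpose A *v x - z))\<^sup>2)"
    and "(LINT (x, z)|\<gamma>. (norm (x - A *v z))\<^sup>2)
      = (LINT (x, z)|\<gamma>. (norm (transpose A *v x - z))\<^sup>2) + (real CARD('n) - real CARD('d))"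
proof -
  note [measurable_cong] = sets_coupling[OF \<gamma>]
  have int_fst: "integrable \<gamma> (\<lambda>p. h (fst p)) \<longleftrightarrow> integrable \<mu> h"
    and lint_fst: "(LINT p|\<gamma>. h (fst p)) = (LINT x|\<mu>. h x)"
    if "h \<in> borel_measurable borel" for h :: "real^'n \<Rightarrow> real"
    using integrable_distr_eq[OF _ that, of fst \<gamma>] integral_distr[OF _ that, of fst \<gamma>]
    by (simp_all add: coupling_fst[OF \<gamma>])
  have x2: "integrable \<gamma> (\<lambda>p. (norm (fst p))\<^sup>2)"
    using int_fst[of "\<lambda>x. (norm x)\<^sup>2"] \<mu> by (simp add: P2_def)
  have z2: "integrable \<gamma> (\<lambda>p. (norm (snd p))\<^sup>2)"
    using integrable_distr_eq[of snd \<gamma> borel "\<lambda>z. (norm z)\<^sup>2"] \<nu>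
    by (simp add: P2_def coupling_snd[OF \<gamma>])
  have sq: "(norm (a - b))\<^sup>2 \<le> 2 * (norm a)\<^sup>2 + 2 * (norm b)\<^sup>2" for a b :: "'v::real_inner"
    using zero_le_power2[of "norm (a + b)"]
    by (simp add: power2_norm_eq_inner inner_add_left inner_add_right inner_diff_left inner_diff_right inner_commute)
  have up: "integrable \<gamma> (\<lambda>p. (norm (fst p - A *v snd p))\<^sup>2)"
    by (rule Bochner_Integration.integrable_bound[where f = "\<lambda>p. 2 * (norm (fst p))\<^sup>2 + 2 * (norm (snd p))\<^sup>2"])
      (use x2 z2 sq[of _ "A *v _"] ortho_mats_norm[OF A] in \<open>auto\<close>)
  have Ax2: "integrable \<gamma> (\<lambda>p. (norm (transpose A *v fst p))\<^sup>2)"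
    using int_fst[of "\<lambda>x. (norm (transpose A *v x))\<^sup>2"] isotropic_norm_matrix_mult(1)[OF iso, of "transpose A"]
    by (simp del: transpose_matrix_vector)
  have eq: "(norm (transpose A *v fst p - snd p))\<^sup>2
      = (norm (fst p - A *v snd p))\<^sup>2 + (norm (transpose A *v fst p))\<^sup>2 - (norm (fst p))\<^sup>2" for p
    using ortho_mats_cost_difference[OF A, of "fst p" "snd p"] by simp
  have down: "integrable \<gamma> (\<lambda>p. (norm (transpose A *v fst p - snd p))\<^sup>2)"
    unfolding eq using up Ax2 x2 by simp
  have "(mat 1 :: real^'n^'n) $ i = axis i 1" for i
    by (auto simp: vec_eq_iff mat_def axis_def)
  then have "(LINT p|\<gamma>. (norm (fst p))\<^sup>2) = real CARD('n)"
    using isotropic_norm_matrix_mult(2)[OF iso, of "mat 1 :: real^'n^'n"] lint_fst[of "\<lambda>x. (norm x)\<^sup>2"]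
    by simp
  moreover have "(LINT p|\<gamma>. (norm (transpose A *v fst p))\<^sup>2) = real CARD('d)"
    using isotropic_norm_matrix_mult(2)[OF iso, of "transpose A"] lint_fst[of "\<lambda>x. (norm (transpose A *v x))\<^sup>2"]
    by (simp add: ortho_mats_norm_transpose_row[OF A] del: transpose_matrix_vector)
  ultimately show "(LINT (x, z)|\<gamma>. (norm (x - A *v z))\<^sup>2)
      = (LINT (x, z)|\<gamma>. (norm (transpose A *v x - z))\<^sup>2) + (real CARD('n) - real CARD('d))"
    unfolding case_prod_beta eq using up Ax2 x2 by simp
  show "integrable \<gamma> (\<lambda>(x, z). (norm (x - A *v z))\<^sup>2)"
    and "integrable \<gamma> (\<lambda>(x, z). (norm (transpose A *v x - z))\<^sup>2)"
    using up down by (simp_all add: split_beta' del: transpose_matrix_vector)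
qed

text \<open>The gluing lemma for constant maps yields the product measure.\<close>

lemma couplings_nonempty:
  assumes "prob_space \<mu>" "sets \<mu> = sets borel" "prob_space \<nu>" "sets \<nu> = sets borel"
  shows "couplings \<mu> \<nu> \<noteq> {}"
proof -
  have law: "distr \<mu> (count_space UNIV) (\<lambda>_. 0 :: nat) = distr \<nu> (count_space UNIV) (\<lambda>_. 0)"
    using assms by (simp add: prob_space.distr_const)
  obtain G where G: "sets G = sets (\<mu> \<Otimes>\<^sub>M \<nu>)" "distr G \<mu> fst = \<mu>" "distr G \<nu> snd = \<nu>"
    by (rule discrete_gluing[OF assms(1,3) _ _ law]) simp_all
  have "sets G = sets (borel \<Otimes>\<^sub>M borel)"
    unfolding G(1) by (rule sets_pair_measure_cong[OF assms(2,4)])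
  moreover have "distr G borel fst = distr G \<mu> fst" "distr G borel snd = distr G \<nu> snd"
    using assms by (auto intro!: distr_cong)
  moreover have "prob_space G"
    using prob_space_distrD[of fst G \<mu>] assms(1) G by (simp add: measurable_cong_sets[OF G(1) refl])
  ultimately have "G \<in> couplings \<mu> \<nu>"
    using G unfolding couplings_def borel_prod by simp
  then show ?thesis by blast
qed

lemma INF_add_const_ennreal:
  fixes h :: "'a \<Rightarrow> ennreal"
  assumes "S \<noteq> {}"
  shows "(INF a\<in>S. h a + c) = (INF a\<in>S. h a) + c"
  using continuous_at_Inf_mono[of "\<lambda>x. x + c" "h ` S"] assms
    continuous_add[of "at_right (Inf (h ` S))", of "\<lambda>x. x" "\<lambda>x. c"]
  by (auto simp: mono_def image_comp)

text \<open>
  Over the common set of couplings of \<open>\<mu>\<close> and \<open>\<nu>\<close> the two cost functions differ by the constant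
  \<open>n - d\<close>, hence so do their infima. Finiteness of the infimum is what makes the conversion to real
  numbers additive.
\<close>

lemma W2_push_up_sq:
  fixes \<mu> :: "(real^'n) measure" and \<nu> :: "(real^'d) measure" and A :: "real^'d^'n"
  assumes le: "CARD('d) \<le> CARD('n)"
    and \<mu>: "\<mu> \<in> P2" and \<nu>: "\<nu> \<in> P2" and iso: "(LINT x|\<mu>. outer x x) = mat 1"
    and A: "A \<in> ortho_mats"
  shows "(W2 \<mu> (push_up A \<nu>))\<^sup>2 = (W2 (push_down A \<mu>) \<nu>)\<^sup>2 + (real CARD('n) - real CARD('d))"
proof -
  have \<mu>': "prob_space \<mu>" "sets \<mu> = sets borel" and \<nu>': "prob_space \<nu>" "sets \<nu> = sets borel"
    using \<mu> \<nu> by (auto simp: P2_def)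
  define r where "r = real CARD('n) - real CARD('d)"
  have r: "r \<ge> 0" using le by (simp add: r_def)
  let ?up = "\<lambda>\<gamma>. \<integral>\<^sup>+ p. ennreal ((norm (fst p - A *v snd p))\<^sup>2) \<partial>\<gamma>"
  let ?down = "\<lambda>\<gamma>. \<integral>\<^sup>+ p. ennreal ((norm (transpose A *v fst p - snd p))\<^sup>2) \<partial>\<gamma>"
  have cost: "?up \<gamma> = ?down \<gamma> + ennreal r" "?down \<gamma> < \<infinity>" if "\<gamma> \<in> couplings \<mu> \<nu>" for \<gamma>
  proof -
    note id = coupling_cost_identity[OF \<mu> \<nu> iso A that, unfolded case_prod_beta]
    show "?up \<gamma> = ?down \<gamma> + ennreal r" "?down \<gamma> < \<infinity>"
      using r nn_integral_eq_integral[OF id(1)] nn_integral_eq_integral[OF id(2)] id(3)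
      by (simp_all add: r_def flip: ennreal_plus)
  qed
  have ne: "couplings \<mu> \<nu> \<noteq> {}" by (rule couplings_nonempty[OF \<mu>' \<nu>'])
  define I where "I = (INF \<gamma>\<in>couplings \<mu> \<nu>. ?down \<gamma>)"
  have I_fin: "I < \<infinity>"
  proof -
    obtain \<gamma> where \<gamma>: "\<gamma> \<in> couplings \<mu> \<nu>" using ne by blast
    then have "I \<le> ?down \<gamma>" unfolding I_def by (rule INF_lower)
    then show ?thesis using cost(2)[OF \<gamma>] by (rule le_less_trans)
  qed
  have dist_meas: "(\<lambda>p :: (real^'n) \<times> (real^'n). ennreal ((norm (fst p - snd p))\<^sup>2)) \<in> borel_measurable borel"
    unfolding borel_prod[symmetric] by measurable
  have up_meas: "(\<lambda>p :: (real^'d) \<times> (real^'n). ennreal ((norm (A *v fst p - snd p))\<^sup>2)) \<in> borel_measurable borel"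
    unfolding borel_prod[symmetric] by measurable
  have "(INF \<gamma>\<in>couplings \<mu> (push_up A \<nu>). \<integral>\<^sup>+ p. ennreal ((norm (fst p - snd p))\<^sup>2) \<partial>\<gamma>)
      = (INF \<gamma>\<in>couplings (push_up A \<nu>) \<mu>. \<integral>\<^sup>+ p. ennreal ((norm (fst p - snd p))\<^sup>2) \<partial>\<gamma>)"
    using dist_meas by (subst INF_couplings_swap) (simp_all add: norm_minus_commute)
  also have "\<dots> = (INF \<gamma>\<in>couplings \<nu> \<mu>. \<integral>\<^sup>+ p. ennreal ((norm (A *v fst p - snd p))\<^sup>2) \<partial>\<gamma>)"
    unfolding push_up_def by (rule INF_couplings_distr[OF \<nu>' \<mu>'(2)]) measurable
  also have "\<dots> = (INF \<gamma>\<in>couplings \<mu> \<nu>. ?up \<gamma>)"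
    using up_meas by (subst INF_couplings_swap) (simp_all add: norm_minus_commute)
  also have "\<dots> = (INF \<gamma>\<in>couplings \<mu> \<nu>. ?down \<gamma> + ennreal r)"
    by (rule INF_cong) (simp_all add: cost)
  also have "\<dots> = I + ennreal r"
    unfolding I_def using ne by (rule INF_add_const_ennreal)
  finally have "(W2 \<mu> (push_up A \<nu>))\<^sup>2 = enn2real (I + ennreal r)"
    by (simp add: W2_def)
  also have "\<dots> = enn2real I + r"
    using I_fin r by (simp add: enn2real_plus)
  also have "I = (INF \<gamma>\<in>couplings (push_down A \<mu>) \<nu>. \<integral>\<^sup>+ p. ennreal ((norm (fst p - snd p))\<^sup>2) \<partial>\<gamma>)"
    unfolding push_down_def I_def by (rule INF_couplings_distr[OF \<mu>' \<nu>'(2), symmetric]) measurable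
  also have "enn2real \<dots> = (W2 (push_down A \<mu>) \<nu>)\<^sup>2"
    by (simp add: W2_def)
  finally show ?thesis by (simp add: r_def)
qed

lemma INF_sqrt_add_const:
  fixes w :: "'a \<Rightarrow> real"
  assumes "S \<noteq> {}" and nonneg: "\<And>a. a \<in> S \<Longrightarrow> 0 \<le> w a" and "0 \<le> r"
  shows "(INF a\<in>S. sqrt ((w a)\<^sup>2 + r)) = sqrt ((INF a\<in>S. w a)\<^sup>2 + r)"
proof (rule antisym)
  have bdd: "bdd_below (w ` S)" by (rule bdd_belowI2[of _ 0]) (rule nonneg)
  have bdd': "bdd_below ((\<lambda>a. sqrt ((w a)\<^sup>2 + r)) ` S)" by (rule bdd_belowI2[of _ 0]) (use \<open>0 \<le> r\<close> in simp)
  have W: "0 \<le> (INF a\<in>S. w a)" by (rule cINF_greatest[OF \<open>S \<noteq> {}\<close> nonneg])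
  let ?Z = "INF a\<in>S. sqrt ((w a)\<^sup>2 + r)"
  show "sqrt ((INF a\<in>S. w a)\<^sup>2 + r) \<le> ?Z"
  proof (rule cINF_greatest[OF \<open>S \<noteq> {}\<close>])
    fix a assume "a \<in> S"
    then have "(INF a\<in>S. w a) \<le> w a" by (rule cINF_lower[OF bdd])
    then show "sqrt ((INF a\<in>S. w a)\<^sup>2 + r) \<le> sqrt ((w a)\<^sup>2 + r)"
      using power_mono[OF _ W, of "w a" 2] by simp
  qed
  have r_le: "sqrt r \<le> ?Z"
    by (rule cINF_greatest[OF \<open>S \<noteq> {}\<close>]) simp
  have Z: "0 \<le> ?Z"
    by (rule order_trans[OF _ r_le]) (simp add: \<open>0 \<le> r\<close>)
  \<comment> \<open>The other direction uses the inverse map \<open>z \<mapsto> sqrt (z\<^sup>2 - r)\<close>.\<close>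
  have "sqrt (?Z\<^sup>2 - r) \<le> (INF a\<in>S. w a)"
  proof (rule cINF_greatest[OF \<open>S \<noteq> {}\<close>])
    fix a assume a: "a \<in> S"
    then have "?Z \<le> sqrt ((w a)\<^sup>2 + r)" by (rule cINF_lower[OF bdd'])
    then have "?Z\<^sup>2 \<le> (w a)\<^sup>2 + r"
      using power_mono[OF _ Z, of "sqrt ((w a)\<^sup>2 + r)" 2] \<open>0 \<le> r\<close> by simp
    then show "sqrt (?Z\<^sup>2 - r) \<le> w a"
      by (intro real_le_lsqrt nonneg[OF a]) simp
  qed
  then have "?Z\<^sup>2 - r \<le> (INF a\<in>S. w a)\<^sup>2" by (rule sqrt_le_D)
  then have "?Z\<^sup>2 \<le> (INF a\<in>S. w a)\<^sup>2 + r" by simp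
  then show "?Z \<le> sqrt ((INF a\<in>S. w a)\<^sup>2 + r)" by (rule real_le_rsqrt)
qed

theorem proposition2p8:
  fixes \<mu> :: "(real^'n) measure" and \<nu> :: "(real^'d) measure"
  assumes "CARD('d) \<le> CARD('n)"
    and "\<mu> \<in> P2" and "\<nu> \<in> P2"
    and "(LINT x|\<mu>. x) = 0"
    and "(LINT x|\<mu>. outer x x) = mat 1"
    and "(LINT z|\<nu>. z) = 0"
    and "(LINT z|\<nu>. outer z z) = mat 1"
  shows "(\<forall>A\<in>(ortho_mats :: (real^'d^'n) set). \<forall>\<gamma>\<in>couplings \<mu> \<nu>.
            integrable \<gamma> (\<lambda>(x, z). (norm (x - A *v z))\<^sup>2) \<and>
            integrable \<gamma> (\<lambda>(x, z). (norm (transpose A *v x - z))\<^sup>2) \<and>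
            (LINT (x, z)|\<gamma>. (norm (x - A *v z))\<^sup>2)
              = (LINT (x, z)|\<gamma>. (norm (transpose A *v x - z))\<^sup>2)
                + (real CARD('n) - real CARD('d)))
       \<and> (W2_up \<mu> \<nu>)\<^sup>2 = (W2_down \<mu> \<nu>)\<^sup>2 + (real CARD('n) - real CARD('d))
       \<and> (\<forall>A\<in>(ortho_mats :: (real^'d^'n) set). optimal_up A \<mu> \<nu> \<longleftrightarrow> optimal_down A \<mu> \<nu>)"
proof -
  define r where "r = real CARD('n) - real CARD('d)"
  have r: "0 \<le> r" using assms(1) by (simp add: r_def)
  let ?H = "ortho_mats :: (real^'d^'n) set"
  let ?w = "\<lambda>A :: real^'d^'n. W2 (push_down A \<mu>) \<nu>"
  have w: "0 \<le> ?w A" for A by (simp add: W2_def)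
  have ne: "?H \<noteq> {}" by (rule ortho_mats_nonempty[OF assms(1)])
  have up: "W2 \<mu> (push_up A \<nu>) = sqrt ((?w A)\<^sup>2 + r)" if "A \<in> ?H" for A
  proof -
    have "(W2 \<mu> (push_up A \<nu>))\<^sup>2 = (?w A)\<^sup>2 + r"
      unfolding r_def by (rule W2_push_up_sq[OF assms(1-3,5) that])
    moreover have "0 \<le> W2 \<mu> (push_up A \<nu>)" by (simp add: W2_def)
    ultimately show ?thesis by (metis real_sqrt_unique)
  qed
  have "W2_up \<mu> \<nu> = (INF A\<in>?H. sqrt ((?w A)\<^sup>2 + r))"
    unfolding W2_up_def by (rule INF_cong) (simp_all add: up)
  also have "\<dots> = sqrt ((W2_down \<mu> \<nu>)\<^sup>2 + r)"
    unfolding W2_down_def by (rule INF_sqrt_add_const[OF ne w r])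
  finally have W_up: "W2_up \<mu> \<nu> = sqrt ((W2_down \<mu> \<nu>)\<^sup>2 + r)" .
  have W_down: "0 \<le> W2_down \<mu> \<nu>"
    unfolding W2_down_def by (rule cINF_greatest[OF ne w])
  have "(W2_up \<mu> \<nu>)\<^sup>2 = (W2_down \<mu> \<nu>)\<^sup>2 + r"
    using r by (simp add: W_up)
  moreover have "optimal_up A \<mu> \<nu> \<longleftrightarrow> optimal_down A \<mu> \<nu>" if "A \<in> ?H" for A
    using that w[of A] W_down by (simp add: optimal_up_def optimal_down_def up W_up)
  ultimately show ?thesis
    using coupling_cost_identity[OF assms(2,3,5)] unfolding r_def by blast
qed

end
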